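(* For all integers $k,n\ge 1$, \begin{align*} &(-1)^{k}\zeta^*(k+1,\underbrace{1,\dots,1}_{n})-(-1)^{n}\zeta^*(n+1,\underbrace{1,\dots,1}_{k})\\ &=k\,\zeta(k+2,\underbrace{1,\dots,1}_{n-1})-n\,\zeta(n+2,\underbrace{1,\dots,1}_{k-1})\\ &\quad+(-1)^{k}\sum_{r=0}^{k-2}(-1)^r\zeta(k-r)\,\zeta(n+1,\underbrace{1,\dots,1}_{r}) -(-1)^{n}\sum_{r=0}^{n-2}(-1)^r\zeta(n-r)\,\zeta(k+1,\underbrace{1,\dots,1}_{r}), \end{align*} where an empty sum (e.g. $\sum_{r=0}^{-1}$) equals $0$.
   Context: For positive integers $k_1,\dots,k_n$ with $k_1\ge 2$, the multiple zeta value is $\zeta(k_1,\dots,k_n)=\sum_{m_1>m_2>\dots>m_n\ge 1}\frac{1}{m_1^{k_1}\cdots m_n^{k_n}}$ and the multiple zeta-star value is $\zeta^*(k_1,\dots,k_n)=\sum_{m_1\ge m_2\ge\dots\ge m_n\ge 1}\frac{1}{m_1^{k_1}\cdots m_n^{k_n}}$. For $n=1$ these are the Riemann zeta value $\zeta(k_1)$. The notation $\underbrace{1,\dots,1}_{r}$ denotes $r$ consecutive entries equal to $1$ (none if $r=0$). *)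

theory Defs
  imports "HOL-Analysis.Analysis"
begin

definition mzv :: "nat list \<Rightarrow> real" where
  "mzv ks = infsum (\<lambda>ms. \<Prod>i<length ks. 1 / real (ms ! i) ^ (ks ! i))
     {ms. length ms = length ks \<and> sorted_wrt (>) ms \<and> (\<forall>m\<in>set ms. 1 \<le> m)}"

definition mzsv :: "nat list \<Rightarrow> real" where
  "mzsv ks = infsum (\<lambda>ms. \<Prod>i<length ks. 1 / real (ms ! i) ^ (ks ! i))
     {ms. length ms = length ks \<and> sorted_wrt (\<ge>) ms \<and> (\<forall>m\<in>set ms. 1 \<le> m)}"

end

(* Put e_r(m) and h_r(m) for the elementary and the complete homogeneous symmetric sums of the
   1/l with l < m and l <= m, so that zeta(a,1,...,1) = sum e_r(m)/m^a and
   zeta*(a,1,...,1) = sum h_r(m)/m^a.  From h_{n}(m)/m = sum_p e_{n-1}(p)/(p(m+p)) and partial fractions,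
     (-1)^k zeta*(k+1,1^n) = (-1)^k sum_{r<k-1} (-1)^r zeta(k-r) zeta(r+2,1^{n-1}) - T(k,n),
   where T(k,n) = sum_m H_m e_{n-1}(m)/m^{k+1}; by duality zeta(r+2,1^{n-1}) = zeta(n+1,1^r).
   It remains to see that T(n,k) - T(k,n) = k zeta(k+2,1^{n-1}) - n zeta(n+2,1^{k-1}).
   For this transport the sum for T(k,n) through the connector m! p!/(m+p)! of Seki and Yamamoto,
   differentiated in a shift of p, and compare with the expansion of H_{m-1} e_r(m) as
   (r+1) e_{r+1}(m) plus the terms of e_r(m) with one l squared. *)
theory Submission
  imports Defs "HOL-Real_Asymp.Real_Asymp"
begin

section \<open>Exchanging and telescoping nonnegative sums\<close>

text \<open>Tonelli for inner index sets that may depend on the outer variable: nonnegativity turns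
  the iterated sum into a sum over pairs, which is then read in the other order. It is used with
  \<open>B x = {x<..}\<close>, where the swapped inner sum is finite, and with constant
  \<open>B\<close>.\<close>

lemma has_sum_exchange:
  fixes f :: "'a \<Rightarrow> 'b \<Rightarrow> real"
  assumes nonneg: "\<And>x y. x \<in> A \<Longrightarrow> y \<in> B x \<Longrightarrow> 0 \<le> f x y"
    and inner: "\<And>x. x \<in> A \<Longrightarrow> (f x has_sum g x) (B x)"
    and outer: "(g has_sum S) A"
    and sub: "\<And>x. x \<in> A \<Longrightarrow> B x \<subseteq> C"
    and inner': "\<And>y. y \<in> C \<Longrightarrow> ((\<lambda>x. f x y) has_sum h y) {x \<in> A. y \<in> B x}"
  shows "(h has_sum S) C"
proof -
  let ?f = "\<lambda>(x, y). f x y"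
  have "?f summable_on Sigma A B"
    by (rule summable_on_SigmaI[where g = g])
      (use nonneg inner outer in \<open>auto simp: summable_on_def\<close>)
  then have "(?f has_sum S) (Sigma A B)"
    using inner outer by (intro has_sum_SigmaI[where g = g]) auto
  also have "(?f has_sum S) (Sigma A B) \<longleftrightarrow>
      ((\<lambda>(y, x). f x y) has_sum S) (Sigma C (\<lambda>y. {x \<in> A. y \<in> B x}))"
    by (rule has_sum_reindex_bij_witness[where i = prod.swap and j = prod.swap])
      (use sub in \<open>auto simp: subset_eq\<close>)
  finally show ?thesis
    by (rule has_sum_Sigma') (use inner' in auto)
qed

text \<open>Nonnegativity upgrades the telescoping series to an unconditional sum. Only
  \<open>m > l\<close> occurs, so \<open>m - 1\<close> is never truncated.\<close>

lemma has_sum_telescope: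
  fixes G f :: "nat \<Rightarrow> real"
  assumes lim: "G \<longlonglongrightarrow> 0"
    and diff: "\<And>m. l < m \<Longrightarrow> f m = G (m - 1) - G m"
    and nonneg: "\<And>m. l < m \<Longrightarrow> 0 \<le> f m"
  shows "(f has_sum G l) {l<..}"
proof -
  have "(\<lambda>i. G (i + l)) \<longlonglongrightarrow> 0"
    using lim by (rule LIMSEQ_ignore_initial_segment)
  from telescope_sums'[OF this] have "(\<lambda>i. f (Suc i + l)) sums G l"
    using diff by simp
  then have "((\<lambda>i. f (Suc i + l)) has_sum G l) UNIV"
    by (rule sums_nonneg_imp_has_sum) (use nonneg in auto)
  moreover have "bij_betw (\<lambda>i. Suc i + l) UNIV {l<..}"
    by (rule bij_betwI[where g = "\<lambda>m. m - Suc l"]) auto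
  ultimately show ?thesis
    using has_sum_reindex_bij_betw[of "\<lambda>i. Suc i + l" UNIV "{l<..}" f] by simp
qed

section \<open>Nested harmonic sums\<close>

text \<open>With \<open>>\<close> for \<open>R\<close> these are the elementary symmetric sums
  e_r(m), with \<open>\<ge>\<close> the complete homogeneous sums h_r(m), so that one argument
  serves both kinds of zeta value.\<close>

primrec nested_sum :: "(nat \<Rightarrow> nat \<Rightarrow> bool) \<Rightarrow> nat \<Rightarrow> nat \<Rightarrow> real" where
  "nested_sum R 0 m = 1"
| "nested_sum R (Suc r) m = (\<Sum>l | 0 < l \<and> R m l. nested_sum R r l / l)"

text \<open>The head of a list is the outer variable \<open>m\<close>; the tails that fit below it
  form a finite set of total weight \<open>nested_sum R r m\<close>. By transitivity a bound on the
  first entry of a tail bounds all the others.\<close>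

lemma has_sum_nested_sum_lists:
  fixes R :: "nat \<Rightarrow> nat \<Rightarrow> bool"
  assumes "transp R" and fin: "\<And>m. finite {l. 0 < l \<and> R m l}"
    and hs: "((\<lambda>m. nested_sum R r m / real m ^ a) has_sum S) {0<..}"
  shows "infsum (\<lambda>ms. \<Prod>i<length (a # replicate r 1). 1 / real (ms ! i) ^ ((a # replicate r 1) ! i))
     {ms. length ms = length (a # replicate r (1::nat)) \<and> sorted_wrt R ms \<and> (\<forall>m\<in>set ms. 1 \<le> m)} = S"
proof -
  define W where "W r m = {ms. length ms = r \<and> sorted_wrt R ms \<and> (\<forall>x\<in>set ms. 0 < x \<and> R m x)}"
    for r m
  define P where "P ms = (\<Prod>i<length ms. 1 / real (ms ! i))" for ms :: "nat list"
  have P_Cons: "P (l # ms) = P ms / l" for l ms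
    by (simp add: P_def prod.lessThan_Suc_shift del: prod.lessThan_Suc)
  have W_Suc: "W (Suc r) m = (\<lambda>(l, ms). l # ms) ` Sigma {l. 0 < l \<and> R m l} (W r)" for r m
  proof (intro set_eqI iffI)
    fix xs assume "xs \<in> W (Suc r) m"
    then obtain l ms where "xs = l # ms" "length ms = r" "sorted_wrt R xs" "\<forall>x\<in>set xs. 0 < x \<and> R m x"
      by (auto simp: W_def length_Suc_conv)
    then have "xs = (\<lambda>(l, ms). l # ms) (l, ms)" "(l, ms) \<in> Sigma {l. 0 < l \<and> R m l} (W r)"
      by (auto simp: W_def)
    then show "xs \<in> (\<lambda>(l, ms). l # ms) ` Sigma {l. 0 < l \<and> R m l} (W r)"
      by (rule image_eqI)
  next
    fix xs assume "xs \<in> (\<lambda>(l, ms). l # ms) ` Sigma {l. 0 < l \<and> R m l} (W r)"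
    then show "xs \<in> W (Suc r) m"
      using transpD[OF \<open>transp R\<close>] by (auto simp: W_def)
  qed
  have inj: "inj_on (\<lambda>(l, ms). l # ms) X" for X :: "(nat \<times> nat list) set"
    by (auto simp: inj_on_def)
  have finite_W: "finite (W r m)" for r m
  proof (induction r arbitrary: m)
    case 0
    have "W 0 m = {[]}" by (auto simp: W_def)
    then show ?case by simp
  next
    case (Suc r)
    show ?case unfolding W_Suc using Suc fin by (intro finite_imageI finite_SigmaI)
  qed
  have sum_W: "(\<Sum>ms\<in>W r m. P ms) = nested_sum R r m" for r m
  proof (induction r arbitrary: m)
    case 0
    have "W 0 m = {[]}" by (auto simp: W_def)
    then show ?case by (simp add: P_def)
  next
    case (Suc r)
    have "(\<Sum>ms\<in>W (Suc r) m. P ms)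
        = (\<Sum>(l, ms)\<in>Sigma {l. 0 < l \<and> R m l} (W r). P ms / real l)"
      unfolding W_Suc by (subst sum.reindex[OF inj]) (simp add: P_Cons case_prod_unfold)
    also have "\<dots> = (\<Sum>l | 0 < l \<and> R m l. \<Sum>ms\<in>W r l. P ms / real l)"
      using fin finite_W by (subst sum.Sigma) auto
    also have "\<dots> = nested_sum R (Suc r) m"
      by (simp add: Suc flip: sum_divide_distrib)
    finally show ?case .
  qed
  let ?f = "\<lambda>(m, ms). P ms / real m ^ a"
  have inner: "((\<lambda>ms. ?f (m, ms)) has_sum nested_sum R r m / real m ^ a) (W r m)" for m
    by (simp add: has_sum_finite_iff finite_W flip: sum_W sum_divide_distrib)
  have P_nonneg: "0 \<le> P ms" for ms by (auto simp: P_def intro: prod_nonneg)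
  have "?f summable_on Sigma {0<..} (W r)"
    by (rule summable_on_SigmaI[OF inner]) (use hs P_nonneg in \<open>auto simp: summable_on_def\<close>)
  then have "(?f has_sum S) (Sigma {0<..} (W r))"
    using inner hs by (intro has_sum_SigmaI) auto
  also have "(?f has_sum S) (Sigma {0<..} (W r)) \<longleftrightarrow>
     ((\<lambda>ms. \<Prod>i<length (a # replicate r 1). 1 / real (ms ! i) ^ ((a # replicate r 1) ! i)) has_sum S)
     {ms. length ms = length (a # replicate r (1::nat)) \<and> sorted_wrt R ms \<and> (\<forall>m\<in>set ms. 1 \<le> m)}"
  proof (rule has_sum_reindex_bij_witness[where i = "\<lambda>ms. (hd ms, tl ms)" and j = "\<lambda>(m, ms). m # ms"])
    fix p assume "p \<in> Sigma {0<..} (W r)"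
    then show "(\<Prod>i<length (a # replicate r 1).
        1 / real ((case p of (m, ms) \<Rightarrow> m # ms) ! i) ^ ((a # replicate r 1) ! i)) = ?f p"
      by (auto simp: W_def P_def prod.lessThan_Suc_shift simp del: prod.lessThan_Suc)
  qed (auto simp: W_def length_Suc_conv Suc_le_eq)
  finally show ?thesis by (rule infsumI)
qed

section \<open>The strict and the weak order: recursions and passage to zeta values\<close>

abbreviation esum :: "nat \<Rightarrow> nat \<Rightarrow> real" where "esum \<equiv> nested_sum (>)"
abbreviation hsum :: "nat \<Rightarrow> nat \<Rightarrow> real" where "hsum \<equiv> nested_sum (\<ge>)"

lemma esum_Suc: "esum (Suc r) m = (\<Sum>l\<in>{0<..<m}. esum r l / l)"
  by (simp add: greaterThanLessThan_def greaterThan_def lessThan_def Collect_conj_eq)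

lemma hsum_Suc_Suc: "hsum (Suc r) (Suc m) = hsum (Suc r) m + hsum r (Suc m) / Suc m"
proof -
  have "{l. 0 < l \<and> l \<le> Suc m} = insert (Suc m) {l. 0 < l \<and> l \<le> m}" by auto
  then show ?thesis by simp
qed

lemma hsum_Suc_0: "hsum (Suc r) 0 = 0"
  by simp

declare nested_sum.simps(2) [simp del]

lemma greaterThanLessThan_Suc: "0 < m \<Longrightarrow> {0<..<Suc m} = insert m {0<..<m}"
  by auto

lemma esum_Suc_Suc: "0 < m \<Longrightarrow> esum (Suc r) (Suc m) = esum (Suc r) m + esum r m / m"
  by (simp add: esum_Suc greaterThanLessThan_Suc)

lemma nested_sum_nonneg: "0 \<le> nested_sum R r m"
  by (induction r arbitrary: m) (auto simp: nested_sum.simps(2) intro!: sum_nonneg)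

lemma finite_positive_below:
  fixes m :: nat
  shows "finite {l. 0 < l \<and> l \<le> m}" "finite {l. 0 < l \<and> l < m}"
  by auto

lemma mzsv_eqI:
  assumes "((\<lambda>m. hsum r m / real m ^ a) has_sum S) {0<..}"
  shows "mzsv (a # replicate r 1) = S"
  unfolding mzsv_def
  by (rule has_sum_nested_sum_lists[OF _ _ assms]) (auto intro!: transpI finite_positive_below)

lemma mzv_eqI:
  assumes "((\<lambda>m. esum r m / real m ^ a) has_sum S) {0<..}"
  shows "mzv (a # replicate r 1) = S"
  unfolding mzv_def
  by (rule has_sum_nested_sum_lists[OF _ _ assms]) (auto intro!: transpI finite_positive_below)

section \<open>Logarithmic growth and convergence\<close>

lemma esum_le_harm_power: "esum r m \<le> harm m ^ r"
proof (induction r arbitrary: m)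
  case (Suc r)
  \<comment> \<open>Enlarging the inner bound from \<open>l\<close> to \<open>m\<close> makes every
    nested layer contribute one factor of at most \<open>harm m\<close>.\<close>
  have "esum (Suc r) m \<le> (\<Sum>l\<in>{0<..<m}. harm m ^ r * inverse (real l))"
    unfolding esum_Suc
  proof (rule sum_mono)
    fix l assume l: "l \<in> {0<..<m}"
    then have "esum r l \<le> harm m ^ r"
      using Suc[of l] harm_mono[of l m, where 'a = real]
      by (meson order_trans power_mono harm_nonneg greaterThanLessThan_iff less_imp_le)
    then show "esum r l / l \<le> harm m ^ r * inverse (real l)"
      by (simp add: divide_inverse mult_right_mono)
  qed
  also have "\<dots> \<le> harm m ^ r * harm m"
    unfolding harm_def sum_distrib_left[symmetric]
    by (intro mult_left_mono sum_mono2) (auto intro!: sum_nonneg zero_le_power)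
  finally show ?case by (simp add: mult.commute)
qed simp

lemma harm_le_ln: "0 < m \<Longrightarrow> harm m \<le> 1 + ln (real m)"
proof -
  assume "0 < m"
  then have "harm (Suc (m - 1)) - ln (real (Suc (m - 1))) \<le> harm (Suc 0) - ln (real (Suc 0))"
    by (intro decseqD[OF decseq_harm_diff_ln]) simp
  then show ?thesis using \<open>0 < m\<close> by (simp add: harm_expand)
qed

text \<open>The numerator is at most a power of \<open>1 + ln m\<close>. Taking \<open>s\<close> as
  0 covers the zeta values, as 1 the sums weighted by harmonic numbers.\<close>

lemma summable_esum_harm:
  assumes "a \<ge> 2"
  shows "(\<lambda>m. esum r m * harm m ^ s / real m ^ a) summable_on {0<..}"
proof -
  let ?g = "\<lambda>m::nat. (1 + ln (real m)) ^ (r + s) / real m ^ 2"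
  have "summable ?g"
  proof (rule summable_comparison_test_bigo)
    \<comment> \<open>Any exponent strictly between 1 and 2 would do: the series converges, and the
      gap to 2 absorbs the logarithms.\<close>
    show "summable (\<lambda>m. norm (real m powr (-(3/2))))"
      by (simp add: summable_real_powr_iff)
    show "?g \<in> O(\<lambda>m. real m powr (-(3/2)))"
      by real_asymp
  qed
  then have g: "?g summable_on {0<..}"
  proof -
    have "eventually (\<lambda>m. 0 \<le> ?g m) sequentially"
      by (rule eventually_sequentiallyI[of 1]) auto
    from summable_nonneg_imp_summable_on_strong[OF \<open>summable ?g\<close> this] show ?thesis
      by (rule summable_on_subset_banach) simp
  qed
  show ?thesis
  proof (rule summable_on_comparison_test[OF g])
    fix m :: nat assume "m \<in> {0<..}"
    then have m: "m > 0" by simp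
    have "esum r m * harm m ^ s \<le> harm m ^ r * harm m ^ s"
      using esum_le_harm_power by (intro mult_right_mono) (auto simp: harm_nonneg)
    also have "\<dots> = harm m ^ (r + s)" by (simp add: power_add)
    also have "\<dots> \<le> (1 + ln (real m)) ^ (r + s)"
      using harm_le_ln[OF m] by (intro power_mono) (auto simp: harm_nonneg)
    finally have "esum r m * harm m ^ s \<le> (1 + ln (real m)) ^ (r + s)" .
    moreover have "real m ^ 2 \<le> real m ^ a"
      using m assms by (intro power_increasing) auto
    ultimately show "esum r m * harm m ^ s / real m ^ a \<le> ?g m"
      using m by (intro frac_le) (auto simp: nested_sum_nonneg harm_nonneg)
    show "0 \<le> esum r m * harm m ^ s / real m ^ a"
      by (simp add: nested_sum_nonneg harm_nonneg)
  qed
qed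

text \<open>For \<open>a \<ge> 2\<close> this is zeta(a,1,...,1) with \<open>r\<close> ones, written
  as a single series.\<close>

definition Z :: "nat \<Rightarrow> nat \<Rightarrow> real" where
  "Z a r = infsum (\<lambda>m. esum r m / real m ^ a) {0<..}"

text \<open>The T(k,n) of the overview is \<open>T (k + 1) (n - 1)\<close>: the arguments here are
  the exponent of \<open>m\<close> and the depth of the nested sum.\<close>

definition T :: "nat \<Rightarrow> nat \<Rightarrow> real" where
  "T a r = infsum (\<lambda>m. esum r m * harm m / real m ^ a) {0<..}"

lemma has_sum_Z: "a \<ge> 2 \<Longrightarrow> ((\<lambda>m. esum r m / real m ^ a) has_sum Z a r) {0<..}"
  unfolding Z_def using summable_esum_harm[of a r 0] by simp

lemma has_sum_T: "a \<ge> 2 \<Longrightarrow> ((\<lambda>m. esum r m * harm m / real m ^ a) has_sum T a r) {0<..}"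
  unfolding T_def using summable_esum_harm[of a r 1] by simp

lemma mzv_eq_Z: "a \<ge> 2 \<Longrightarrow> mzv (a # replicate r 1) = Z a r"
  by (rule mzv_eqI) (rule has_sum_Z)

section \<open>The connector and its derivative\<close>

text \<open>The reciprocal of the binomial coefficient of \<open>m + p\<close> over
  \<open>m\<close>.\<close>

definition conn :: "nat \<Rightarrow> nat \<Rightarrow> real" where
  "conn m p = fact m * fact p / fact (m + p)"

text \<open>The negative of the derivative at \<open>\<alpha> = 0\<close> of
  \<open>m! \<Gamma>(p + \<alpha> + 1) / \<Gamma>(m + p + \<alpha> + 1)\<close>.\<close>

definition dconn :: "nat \<Rightarrow> nat \<Rightarrow> real" where
  "dconn m p = conn m p * (harm (m + p) - harm p)"

lemma conn_commute: "conn m p = conn p m"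
  by (simp add: conn_def add.commute mult.commute)

lemma conn_0 [simp]: "conn m 0 = 1" "conn 0 p = 1"
  by (simp_all add: conn_def)

lemma dconn_0 [simp]: "dconn m 0 = harm m" "dconn 0 p = 0"
  by (simp_all add: dconn_def harm_expand)

lemma conn_Suc_right: "conn m p = conn m (Suc p) * (m + Suc p) / Suc p"
  by (simp add: conn_def divide_simps)

section \<open>Sign and decay of the connector and its derivative\<close>

lemma conn_nonneg: "0 \<le> conn m p"
  by (simp add: conn_def)

lemma dconn_nonneg: "0 \<le> dconn m p"
  by (simp add: dconn_def conn_nonneg harm_mono)

text \<open>The connector decreases in \<open>m\<close>, and at \<open>m = 1\<close> it equals
  \<open>1 / Suc p\<close>.\<close>

lemma conn_le: "0 < m \<Longrightarrow> conn m p \<le> 1 / Suc p"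
proof (induction m rule: nat_induct_non_zero)
  case 1
  show ?case by (simp add: conn_def)
next
  case (Suc m)
  have "conn (Suc m) p = conn m p * (Suc m / (Suc m + p))"
    by (simp add: conn_def divide_simps)
  also have "\<dots> \<le> conn m p * 1"
    by (intro mult_left_mono) (auto simp: conn_nonneg)
  finally show ?case using Suc by simp
qed

lemma conn_tendsto_0: "0 < m \<Longrightarrow> conn m \<longlonglongrightarrow> 0"
proof (rule Lim_null_comparison)
  assume "0 < m"
  then show "\<forall>\<^sub>F p in sequentially. norm (conn m p) \<le> 1 / real (Suc p)"
    using conn_le by (auto simp: conn_nonneg)
  show "(\<lambda>p. 1 / real (Suc p)) \<longlonglongrightarrow> 0" by real_asymp
qed

lemma dconn_le: "dconn m p \<le> conn m p * (1 + ln (real (m + p) + 1))"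
proof -
  have "harm (m + p) \<le> 1 + ln (real (m + p) + 1)"
    using harm_le_ln[of "m + p"] by (cases "m + p = 0") (auto simp: harm_expand intro: order_trans)
  then show ?thesis unfolding dconn_def
    by (intro mult_left_mono) (use harm_nonneg[of p, where 'a = real] conn_nonneg in auto)
qed

lemma dconn_tendsto_0: "0 < m \<Longrightarrow> dconn m \<longlonglongrightarrow> 0"
proof (rule Lim_null_comparison)
  assume m: "0 < m"
  have "dconn m p \<le> 1 / real (Suc p) * (1 + ln (real (m + p) + 1))" for p
    using dconn_le[of m p] conn_le[OF m, of p]
    by (elim order_trans) (intro mult_right_mono, auto)
  then show "\<forall>\<^sub>F p in sequentially. norm (dconn m p) \<le> 1 / real (Suc p) * (1 + ln (real m + real p + 1))"
    by (simp add: dconn_nonneg)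
  show "(\<lambda>p. 1 / real (Suc p) * (1 + ln (real m + real p + 1))) \<longlonglongrightarrow> 0" by real_asymp
qed

lemma dconn_left_tendsto_0: "0 < p \<Longrightarrow> (\<lambda>m. dconn m p) \<longlonglongrightarrow> 0"
proof (rule Lim_null_comparison)
  assume p: "0 < p"
  have "dconn m p \<le> 1 / real (Suc m) * (1 + ln (real (m + p) + 1))" for m
    using dconn_le[of m p] conn_le[OF p, of m] unfolding conn_commute[of m p]
    by (elim order_trans) (intro mult_right_mono, auto)
  then show "\<forall>\<^sub>F m in sequentially. norm (dconn m p) \<le> 1 / real (Suc m) * (1 + ln (real m + real p + 1))"
    by (simp add: dconn_nonneg)
  show "(\<lambda>m. 1 / real (Suc m) * (1 + ln (real m + real p + 1))) \<longlonglongrightarrow> 0" by real_asymp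
qed

text \<open>Since \<open>conn m (q - 1) = conn m q * (m + q) / q\<close>, consecutive values differ
  by \<open>m * conn m q / q\<close>. Thus a factor \<open>1 / m\<close> is traded for a new
  summation variable above \<open>p\<close>.\<close>

lemma has_sum_conn:
  assumes "0 < m"
  shows "((\<lambda>q. conn m q / q) has_sum conn m p / m) {p<..}"
proof (rule has_sum_telescope[where G = "\<lambda>q. conn m q / m"])
  show "(\<lambda>q. conn m q / m) \<longlonglongrightarrow> 0"
    using tendsto_divide[OF conn_tendsto_0[OF assms] tendsto_const[of "real m"]] assms by simp
  fix q assume "p < q"
  then obtain q' where q: "q = Suc q'" by (cases q) auto
  show "conn m q / q = conn m (q - 1) / m - conn m q / m"
    unfolding q diff_Suc_1 conn_Suc_right[of m q'] using assms
    by (simp add: divide_simps) (simp add: algebra_simps)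
qed (simp add: conn_nonneg)

lemma has_sum_conn_left:
  assumes "0 < p"
  shows "((\<lambda>m. conn m p / m) has_sum conn l p / p) {l<..}"
  using has_sum_conn[OF assms, of l] by (simp add: conn_commute[of _ p])

text \<open>This is \<open>has_sum_conn\<close> with \<open>p\<close> and \<open>q\<close> shifted
  by \<alpha>, after minus the derivative at 0: the extra term with \<open>q\<close> squared comes
  from differentiating 1/(q+\<alpha>).\<close>

lemma has_sum_dconn:
  assumes "0 < m"
  shows "((\<lambda>q. dconn m q / q + conn m q / real q ^ 2) has_sum dconn m p / m) {p<..}"
proof (rule has_sum_telescope[where G = "\<lambda>q. dconn m q / m"])
  show "(\<lambda>q. dconn m q / m) \<longlonglongrightarrow> 0"
    using tendsto_divide[OF dconn_tendsto_0[OF assms] tendsto_const[of "real m"]] assms by simp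
  fix q assume "p < q"
  then obtain q' where q: "q = Suc q'" by (cases q) auto
  define x y c where "x = (harm (m + q) :: real)" and "y = (harm q :: real)" and "c = conn m q"
  have h: "harm (m + q') = x - 1 / (m + q)" "harm q' = y - 1 / q"
    by (simp_all add: x_def y_def q harm_Suc inverse_eq_divide)
  have pos: "real q > 0" "real m > 0" using assms q by auto
  have "dconn m q' = c * (m + q) / q * ((x - 1 / (m + q)) - (y - 1 / q))"
    unfolding dconn_def h by (simp add: c_def q conn_Suc_right[of m q'])
  also have "\<dots> = c / q * ((real m + real q) * (x - y) + m / q)"
    using pos by (simp add: divide_simps) (simp add: algebra_simps)
  finally have 1: "dconn m q' = c / q * ((real m + real q) * (x - y) + m / q)" .
  have 2: "dconn m q = c * (x - y)" by (simp add: dconn_def x_def y_def c_def)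
  have "dconn m q / q + c / real q ^ 2 = dconn m q' / m - dconn m q / m"
    unfolding 1 2 using pos by (simp add: divide_simps power2_eq_square) (simp add: algebra_simps)
  then show "dconn m q / q + conn m q / real q ^ 2 = dconn m (q - 1) / m - dconn m q / m"
    by (simp add: c_def q)
qed (simp add: conn_nonneg dconn_nonneg)

text \<open>The shift affects only \<open>p\<close>, so here the differentiated factor is
  1/(p+\<alpha>) on the right-hand side; hence the asymmetry with
  \<open>has_sum_dconn\<close>.\<close>

lemma has_sum_dconn_left:
  assumes "0 < p"
  shows "((\<lambda>m. dconn m p / m) has_sum (dconn l p / p + conn l p / real p ^ 2)) {l<..}"
proof (rule has_sum_telescope[where G = "\<lambda>m. dconn m p / p + conn m p / real p ^ 2"])
  show "(\<lambda>m. dconn m p / p + conn m p / real p ^ 2) \<longlonglongrightarrow> 0"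
    using tendsto_add[OF tendsto_divide[OF dconn_left_tendsto_0[OF assms] tendsto_const[of "real p"]]
        tendsto_divide[OF conn_tendsto_0[OF assms] tendsto_const[of "real p ^ 2"]]] assms
    by (simp add: conn_commute[of _ p])
  fix m assume "l < m"
  then obtain m' where m: "m = Suc m'" by (cases m) auto
  define x y c where "x = (harm (m + p) :: real)" and "y = (harm p :: real)" and "c = conn m p"
  have h: "harm (m' + p) = x - 1 / (m + p)"
    by (simp add: x_def m harm_Suc inverse_eq_divide)
  have c: "conn m' p = c * (m + p) / m"
    using conn_Suc_right[of p m'] by (simp add: c_def m conn_commute[of _ p] add_ac)
  have pos: "real m > 0" "real p > 0" using assms m by auto
  have "dconn m' p = c * (m + p) / m * ((x - 1 / (m + p)) - y)"
    unfolding dconn_def h c by (simp add: y_def)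
  also have "\<dots> = c / m * ((real m + real p) * (x - y) - 1)"
    using pos by (simp add: divide_simps) (simp add: algebra_simps)
  finally have 1: "dconn m' p = c / m * ((real m + real p) * (x - y) - 1)" .
  have 2: "dconn m p = c * (x - y)" by (simp add: dconn_def x_def y_def c_def)
  have "dconn m p / m = dconn m' p / p + conn m' p / real p ^ 2 - (dconn m p / p + c / real p ^ 2)"
    unfolding c 1 2 using pos by (simp add: divide_simps power2_eq_square) (simp add: algebra_simps)
  then show "dconn m p / m = dconn (m - 1) p / p + conn (m - 1) p / real p ^ 2
      - (dconn m p / p + conn m p / real p ^ 2)"
    by (simp add: c_def m)
qed (simp add: dconn_nonneg)

section \<open>Transport of sums through the connector\<close>

lemma restrict_Ioi: "{l \<in> {0::nat<..}. m \<in> {l<..}} = {0<..<m}"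
  by auto

text \<open>Start from \<open>conn 0 p = 1\<close>. Each further layer of the nested sum is
  collapsed by \<open>has_sum_conn_left\<close> and leaves one more factor
  \<open>1 / p\<close>.\<close>

lemma has_sum_esum_conn:
  assumes "0 < p"
  shows "((\<lambda>m. esum n m / m * conn m p) has_sum 1 / real p ^ Suc n) {0<..}"
proof (induction n)
  case 0
  show ?case using has_sum_conn_left[OF assms, of 0] by simp
next
  case (Suc n)
  show ?case
  proof (rule has_sum_exchange[where A = "{0<..}" and B = "\<lambda>l. {l<..}"
        and f = "\<lambda>l m. esum n l / l * (conn m p / m)"
        and g = "\<lambda>l. esum n l / l * (conn l p / p)"])
    show "((\<lambda>l. esum n l / l * (conn l p / p)) has_sum 1 / real p ^ Suc (Suc n)) {0<..}"
      using has_sum_cmult_left[OF Suc, of "1 / p"] by (simp add: mult_ac)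
    fix m :: nat
    have "(\<Sum>l\<in>{0<..<m}. esum n l / l * (conn m p / m)) = esum (Suc n) m * (conn m p / m)"
      by (simp only: esum_Suc sum_distrib_right)
    then show "((\<lambda>l. esum n l / l * (conn m p / m)) has_sum esum (Suc n) m / m * conn m p)
        {l \<in> {0<..}. m \<in> {l<..}}"
      unfolding restrict_Ioi by (simp add: has_sum_finite_iff mult_ac)
    fix l :: nat
    show "((\<lambda>m. esum n l / l * (conn m p / m)) has_sum esum n l / l * (conn l p / p)) {l<..}"
      by (intro has_sum_cmult_right has_sum_conn_left assms)
  qed (auto intro!: mult_nonneg_nonneg divide_nonneg_nonneg
      simp: nested_sum_nonneg conn_nonneg assms)
qed

text \<open>Minus the derivative of the previous identity in the shift of \<open>p\<close>: the
  power (p+\<alpha>)^(-n-1) produces the factor \<open>Suc n\<close>.\<close>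

lemma has_sum_esum_dconn:
  assumes "0 < p"
  shows "((\<lambda>m. esum n m / m * dconn m p) has_sum Suc n / real p ^ Suc (Suc n)) {0<..}"
proof (induction n)
  case 0
  show ?case using has_sum_dconn_left[OF assms, of 0] by (simp add: power2_eq_square)
next
  case (Suc n)
  show ?case
  proof (rule has_sum_exchange[where A = "{0<..}" and B = "\<lambda>l. {l<..}"
        and f = "\<lambda>l m. esum n l / l * (dconn m p / m)"
        and g = "\<lambda>l. esum n l / l * (dconn l p / p + conn l p / real p ^ 2)"])
    have "((\<lambda>l. esum n l / l * dconn l p * (1 / p) + esum n l / l * conn l p * (1 / real p ^ 2)) has_sum
        Suc n / real p ^ Suc (Suc n) * (1 / p) + 1 / real p ^ Suc n * (1 / real p ^ 2)) {0<..}"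
      by (intro has_sum_add has_sum_cmult_left Suc has_sum_esum_conn assms)
    moreover have "Suc n / real p ^ Suc (Suc n) * (1 / p) + 1 / real p ^ Suc n * (1 / real p ^ 2)
        = Suc (Suc n) / real p ^ Suc (Suc (Suc n))"
      using assms by (simp add: divide_simps power2_eq_square)
    ultimately show "((\<lambda>l. esum n l / l * (dconn l p / p + conn l p / real p ^ 2)) has_sum
        Suc (Suc n) / real p ^ Suc (Suc (Suc n))) {0<..}"
      by (simp add: ring_distribs mult_ac)
    fix m :: nat
    have "(\<Sum>l\<in>{0<..<m}. esum n l / l * (dconn m p / m)) = esum (Suc n) m * (dconn m p / m)"
      by (simp only: esum_Suc sum_distrib_right)
    then show "((\<lambda>l. esum n l / l * (dconn m p / m)) has_sum esum (Suc n) m / m * dconn m p)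
        {l \<in> {0<..}. m \<in> {l<..}}"
      unfolding restrict_Ioi by (simp add: has_sum_finite_iff mult_ac)
    fix l :: nat
    show "((\<lambda>m. esum n l / l * (dconn m p / m)) has_sum
        esum n l / l * (dconn l p / p + conn l p / real p ^ 2)) {l<..}"
      by (intro has_sum_cmult_right has_sum_dconn_left assms)
  qed (auto intro!: mult_nonneg_nonneg divide_nonneg_nonneg
      simp: nested_sum_nonneg dconn_nonneg assms)
qed

lemma has_sum_diff_real:
  fixes f g :: "'a \<Rightarrow> real"
  assumes "(f has_sum a) A" "(g has_sum b) A"
  shows "((\<lambda>x. f x - g x) has_sum a - b) A"
  using has_sum_add[OF assms(1), of "\<lambda>x. - g x" "- b"] assms(2) by (simp add: has_sum_uminus)

text \<open>The double sum of \<open>esum n m * esum k p * conn m p / (m * p)\<close> is symmetric;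
  summing out \<open>p\<close> or \<open>m\<close> first gives the two sides.\<close>

lemma Z_duality: "Z (k + 2) n = Z (n + 2) k"
proof -
  have "((\<lambda>p. esum k p / real p ^ (n + 2)) has_sum Z (k + 2) n) {0<..}"
  proof (rule has_sum_exchange[where A = "{0<..}" and B = "\<lambda>_. {0<..}"
        and f = "\<lambda>m p. esum n m / m * (esum k p / p * conn p m)"
        and g = "\<lambda>m. esum n m / m * (1 / real m ^ Suc k)"])
    show "((\<lambda>m. esum n m / m * (1 / real m ^ Suc k)) has_sum Z (k + 2) n) {0<..}"
      using has_sum_Z[of "k + 2" n] by (simp add: mult_ac)
    fix p :: nat assume p: "p \<in> {0<..}"
    then have "((\<lambda>m. esum k p / p * (esum n m / m * conn m p)) has_sum esum k p / p * (1 / real p ^ Suc n)) {0<..}"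
      by (intro has_sum_cmult_right has_sum_esum_conn) auto
    with p show "((\<lambda>m. esum n m / m * (esum k p / p * conn p m)) has_sum esum k p / real p ^ (n + 2))
       {m \<in> {0<..}. p \<in> {0<..}}"
      by (simp add: mult_ac conn_commute[of p] greaterThan_def)
    show "((\<lambda>p. esum n m / m * (esum k p / p * conn p m)) has_sum
        esum n m / m * (1 / real m ^ Suc k)) {0<..}" if "m \<in> {0<..}" for m
      using that by (intro has_sum_cmult_right has_sum_esum_conn) auto
  qed (auto intro!: mult_nonneg_nonneg divide_nonneg_nonneg
      simp: nested_sum_nonneg conn_nonneg)
  then show ?thesis
    using has_sum_Z[of "n + 2" k] by (auto dest: has_sum_unique)
qed

text \<open>The sum of \<open>1 / (l\<^sub>1 \<cdots> l\<^sub>r)\<close> over \<open>m > l\<^sub>1 > \<dots> > l\<^sub>r > 0\<close>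
  with one of the \<open>l\<^sub>i\<close> squared.\<close>

primrec rsum :: "nat \<Rightarrow> nat \<Rightarrow> real" where
  "rsum 0 m = 0"
| "rsum (Suc r) m = (\<Sum>l\<in>{0<..<m}. (esum r l / l + rsum r l) / l)"

declare rsum.simps(2) [simp del]

lemma rsum_nonneg: "0 \<le> rsum r m"
  by (induction r arbitrary: m)
    (auto simp: rsum.simps(2) nested_sum_nonneg intro!: sum_nonneg divide_nonneg_nonneg add_nonneg_nonneg)

lemma rsum_Suc_Suc: "0 < m \<Longrightarrow> rsum (Suc r) (Suc m) = rsum (Suc r) m + (esum r m / m + rsum r m) / m"
  by (simp add: rsum.simps(2) greaterThanLessThan_Suc)

text \<open>Multiplying by one more reciprocal either adds a new index, and each set of
  \<open>Suc r\<close> indices arises \<open>Suc r\<close> times, or repeats an index, which squares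
  it. Strictness at \<open>Suc m\<close> means that all indices run up to \<open>m\<close>, as in
  \<open>harm m\<close>.\<close>

lemma esum_mult_harm:
  "esum r (Suc m) * harm m = Suc r * esum (Suc r) (Suc m) + rsum r (Suc m)"
proof (induction m arbitrary: r)
  case 0
  show ?case
    by (cases r) (auto simp: harm_expand esum_Suc rsum.simps(2) greaterThanLessThan_def greaterThan_def lessThan_def)
next
  case (Suc m)
  show ?case
  proof (cases r)
    case 0
    then show ?thesis using Suc[of 0] by (simp add: esum_Suc_Suc harm_Suc inverse_eq_divide)
  next
    case (Suc q)
    have 1: "esum (Suc q) (Suc m) * harm m = Suc (Suc q) * esum (Suc (Suc q)) (Suc m) + rsum (Suc q) (Suc m)"
      and 2: "esum q (Suc m) * harm m = Suc q * esum (Suc q) (Suc m) + rsum q (Suc m)"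
      using Suc.IH by blast+
    \<comment> \<open>With \<open>t\<close> for the reciprocal, the induction step becomes a
      polynomial identity.\<close>
    define t where "t = 1 / real (Suc m)"
    have t: "x / real (Suc m) = x * t" for x
      by (simp add: t_def)
    have "esum r (Suc (Suc m)) * harm (Suc m)
        = esum (Suc q) (Suc m) * harm m + t * (esum q (Suc m) * harm m)
          + t * (esum (Suc q) (Suc m)) + t * t * esum q (Suc m)"
      by (simp add: Suc esum_Suc_Suc harm_Suc inverse_eq_divide t algebra_simps del: of_nat_Suc)
    also have "\<dots> = Suc r * esum (Suc r) (Suc (Suc m)) + rsum r (Suc (Suc m))"
      unfolding 1 2
      by (simp add: Suc esum_Suc_Suc rsum_Suc_Suc t of_nat_Suc[of "Suc q"] of_nat_Suc[of q]
          algebra_simps del: of_nat_Suc)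
    finally show ?thesis .
  qed
qed

text \<open>Transport starting from \<open>dconn m 0 = harm m\<close>. By the product rule the
  derivative hits either the connector, or the newest denominator, or an older one; the last two
  cases give \<open>esum k p / p\<close> and \<open>rsum k p\<close>.\<close>

lemma has_sum_harm_over_power:
  assumes "0 < m"
  shows "((\<lambda>p. esum k p / p * dconn m p + (esum k p / p + rsum k p) / p * conn m p)
    has_sum harm m / real m ^ Suc k) {0<..}"
proof (induction k)
  case 0
  show ?case using has_sum_dconn[OF assms, of 0] by (simp add: power2_eq_square)
next
  case (Suc k)
  let ?r = "\<lambda>p. (esum k p / p + rsum k p) / p"
  show ?case
  proof (rule has_sum_exchange[where A = "{0<..}" and B = "\<lambda>p. {p<..}"
        and f = "\<lambda>p q. esum k p / p * (dconn m q / q + conn m q / real q ^ 2) + ?r p * (conn m q / q)"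
        and g = "\<lambda>p. esum k p / p * (dconn m p / m) + ?r p * (conn m p / m)"])
    show "((\<lambda>p. esum k p / p * (dconn m p / m) + ?r p * (conn m p / m))
        has_sum harm m / real m ^ Suc (Suc k)) {0<..}"
      using has_sum_cmult_left[OF Suc, of "1 / m"] by (simp add: ring_distribs mult_ac)
    fix q :: nat
    have "(\<Sum>p\<in>{0<..<q}. esum k p / p * (dconn m q / q + conn m q / real q ^ 2) + ?r p * (conn m q / q))
        = esum (Suc k) q * (dconn m q / q + conn m q / real q ^ 2) + rsum (Suc k) q * (conn m q / q)"
      unfolding esum_Suc rsum.simps(2) by (simp only: sum.distrib sum_distrib_right)
    also have "\<dots> = esum (Suc k) q / q * dconn m q + (esum (Suc k) q / q + rsum (Suc k) q) / q * conn m q"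
      by (simp add: ring_distribs add_divide_distrib power2_eq_square)
    finally show "((\<lambda>p. esum k p / p * (dconn m q / q + conn m q / real q ^ 2) + ?r p * (conn m q / q))
      has_sum esum (Suc k) q / q * dconn m q + (esum (Suc k) q / q + rsum (Suc k) q) / q * conn m q)
        {l \<in> {0<..}. q \<in> {l<..}}"
      unfolding restrict_Ioi by (simp add: has_sum_finite_iff)
    fix p :: nat
    show "((\<lambda>q. esum k p / p * (dconn m q / q + conn m q / real q ^ 2) + ?r p * (conn m q / q))
      has_sum esum k p / p * (dconn m p / m) + ?r p * (conn m p / m)) {p<..}"
      using has_sum_dconn[OF assms] has_sum_conn[OF assms] by (intro has_sum_add has_sum_cmult_right)
  qed (auto intro!: mult_nonneg_nonneg
      divide_nonneg_nonneg add_nonneg_nonneg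
      simp: nested_sum_nonneg rsum_nonneg conn_nonneg dconn_nonneg assms)
qed

text \<open>Expand \<open>harm m\<close> in \<open>T (k + 2) n\<close> by the transport and sum out
  \<open>m\<close>. In the difference with \<open>T (n + 2) k\<close> the \<open>rsum\<close> terms
  cancel, as does one copy of \<open>esum k p / p ^ (n + 3)\<close>.\<close>

lemma T_swap:
  "T (n + 2) k - T (k + 2) n = Suc k * Z (n + 2) (Suc k) - Suc n * Z (n + 3) k"
proof -
  let ?r = "\<lambda>p. (esum k p / p + rsum k p) / p"
  have "((\<lambda>p. esum k p / p * (Suc n / real p ^ Suc (Suc n)) + ?r p * (1 / real p ^ Suc n)) has_sum T (k + 2) n) {0<..}"
  proof (rule has_sum_exchange[where A = "{0<..}" and B = "\<lambda>_. {0<..}"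
        and f = "\<lambda>m p. esum n m / m * (esum k p / p * dconn m p + ?r p * conn m p)"
        and g = "\<lambda>m. esum n m / m * (harm m / real m ^ Suc k)"])
    show "((\<lambda>m. esum n m / m * (harm m / real m ^ Suc k)) has_sum T (k + 2) n) {0<..}"
      using has_sum_T[of "k + 2" n] by (simp add: mult_ac)
    fix p :: nat assume p: "p \<in> {0<..}"
    then have "((\<lambda>m. esum k p / p * (esum n m / m * dconn m p) + ?r p * (esum n m / m * conn m p)) has_sum
        esum k p / p * (Suc n / real p ^ Suc (Suc n)) + ?r p * (1 / real p ^ Suc n)) {0<..}"
      by (intro has_sum_add has_sum_cmult_right has_sum_esum_conn has_sum_esum_dconn) auto
    also have "(\<lambda>m. esum k p / p * (esum n m / m * dconn m p) + ?r p * (esum n m / m * conn m p))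
        = (\<lambda>m. esum n m / m * (esum k p / p * dconn m p + ?r p * conn m p))"
      by (simp add: fun_eq_iff ring_distribs add_divide_distrib mult_ac)
    finally show "((\<lambda>m. esum n m / m * (esum k p / p * dconn m p + ?r p * conn m p)) has_sum
        esum k p / p * (Suc n / real p ^ Suc (Suc n)) + ?r p * (1 / real p ^ Suc n)) {m \<in> {0<..}. p \<in> {0<..}}"
      using p by (simp add: greaterThan_def)
    show "((\<lambda>p. esum n m / m * (esum k p / p * dconn m p + ?r p * conn m p)) has_sum
        esum n m / m * (harm m / real m ^ Suc k)) {0<..}" if "m \<in> {0<..}" for m
      using that by (intro has_sum_cmult_right has_sum_harm_over_power) auto
  qed (auto intro!: mult_nonneg_nonneg
      divide_nonneg_nonneg add_nonneg_nonneg
      simp: nested_sum_nonneg rsum_nonneg conn_nonneg dconn_nonneg)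
  then have "((\<lambda>p. esum k p * harm p / real p ^ (n + 2)
        - (esum k p / p * (Suc n / real p ^ Suc (Suc n)) + ?r p * (1 / real p ^ Suc n)))
      has_sum T (n + 2) k - T (k + 2) n) {0<..}"
    by (intro has_sum_diff_real has_sum_T) auto
  also have "?this \<longleftrightarrow> ((\<lambda>p. Suc k * (esum (Suc k) p / real p ^ (n + 2)) - Suc n * (esum k p / real p ^ (n + 3)))
      has_sum T (n + 2) k - T (k + 2) n) {0<..}"
  proof (rule has_sum_cong)
    fix p :: nat assume "p \<in> {0<..}"
    then obtain q where q: "p = Suc q" by (cases p) auto
    define x where "x = real p"
    have x: "x > 0" by (simp add: x_def q)
    \<comment> \<open>\<open>esum_mult_harm\<close> covers the indices below \<open>p\<close>; the
      last term of \<open>harm p\<close> is added separately.\<close>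
    have *: "esum k p * harm p = Suc k * esum (Suc k) p + rsum k p + esum k p / x"
      using esum_mult_harm[of k q]
      by (simp add: q harm_Suc ring_distribs inverse_eq_divide x_def del: of_nat_Suc)
    show "esum k p * harm p / real p ^ (n + 2)
        - (esum k p / p * (Suc n / real p ^ Suc (Suc n)) + ?r p * (1 / real p ^ Suc n))
      = Suc k * (esum (Suc k) p / real p ^ (n + 2)) - Suc n * (esum k p / real p ^ (n + 3))"
      unfolding * x_def[symmetric] using x
      by (simp add: divide_simps power3_eq_cube power2_eq_square power_add) (simp add: algebra_simps)
  qed
  finally have "((\<lambda>p. Suc k * (esum (Suc k) p / real p ^ (n + 2)) - Suc n * (esum k p / real p ^ (n + 3)))
      has_sum T (n + 2) k - T (k + 2) n) {0<..}" .
  moreover have "((\<lambda>p. Suc k * (esum (Suc k) p / real p ^ (n + 2)) - Suc n * (esum k p / real p ^ (n + 3)))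
      has_sum Suc k * Z (n + 2) (Suc k) - Suc n * Z (n + 3) k) {0<..}"
    by (intro has_sum_diff_real has_sum_cmult_right has_sum_Z) auto
  ultimately show ?thesis by (rule has_sum_unique)
qed

section \<open>Star sums\<close>

lemma has_sum_shifted_product:
  "((\<lambda>p. 1 / (real (m + p) * real (Suc m + p))) has_sum 1 / real (Suc m + l)) {l<..}"
proof (rule has_sum_telescope[where G = "\<lambda>p. 1 / real (Suc m + p)"])
  show "(\<lambda>p. 1 / real (Suc m + p)) \<longlonglongrightarrow> 0" by real_asymp
  fix p assume "l < p"
  then obtain q where "p = Suc q" by (cases p) auto
  then show "1 / (real (m + p) * real (Suc m + p)) = 1 / real (Suc m + (p - 1)) - 1 / real (Suc m + p)"
    by (simp add: divide_simps)
qed auto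

text \<open>Passes from one depth to the next in \<open>has_sum_hsum\<close>: open the outer layer
  of \<open>esum (Suc n) p\<close> and sum over \<open>p > l\<close> first.\<close>

lemma has_sum_esum_shifted_product:
  assumes "((\<lambda>p. esum n p / p * (real (Suc m) / real (Suc m + p))) has_sum hsum (Suc n) (Suc m)) {0<..}"
  shows "((\<lambda>p. esum (Suc n) p / (real (m + p) * real (Suc m + p))) has_sum
    hsum (Suc n) (Suc m) / Suc m) {0<..}"
proof (rule has_sum_exchange[where A = "{0<..}" and B = "\<lambda>l. {l<..}"
      and f = "\<lambda>l p. esum n l / l * (1 / (real (m + p) * real (Suc m + p)))"
      and g = "\<lambda>l. esum n l / l * (1 / real (Suc m + l))"])
  show "((\<lambda>l. esum n l / l * (1 / real (Suc m + l))) has_sum hsum (Suc n) (Suc m) / Suc m) {0<..}"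
    using has_sum_cmult_left[OF assms, of "1 / Suc m"] by simp
  fix l :: nat
  show "((\<lambda>p. esum n l / l * (1 / (real (m + p) * real (Suc m + p)))) has_sum
      esum n l / l * (1 / real (Suc m + l))) {l<..}"
    by (intro has_sum_cmult_right has_sum_shifted_product)
  fix p :: nat
  have "(\<Sum>l\<in>{0<..<p}. esum n l / l * (1 / (real (m + p) * real (Suc m + p))))
      = esum (Suc n) p * (1 / (real (m + p) * real (Suc m + p)))"
    by (simp only: esum_Suc sum_distrib_right)
  then show "((\<lambda>l. esum n l / l * (1 / (real (m + p) * real (Suc m + p)))) has_sum
      esum (Suc n) p / (real (m + p) * real (Suc m + p))) {l \<in> {0<..}. p \<in> {l<..}}"
    unfolding restrict_Ioi by (simp add: has_sum_finite_iff)
qed (auto intro!: mult_nonneg_nonneg divide_nonneg_nonneg simp: nested_sum_nonneg)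

lemma has_sum_hsum:
  "((\<lambda>p. esum n p / p * (real m / real (m + p))) has_sum hsum (Suc n) m) {0<..}"
proof (induction n arbitrary: m)
  \<comment> \<open>Induction on \<open>m\<close>: the summand grows by
    \<open>esum n p / ((m + p) * (m + 1 + p))\<close>, and \<open>hsum (Suc n)\<close> grows by
    \<open>hsum n (Suc m) / Suc m\<close>. So matching these increments suffices.\<close>
  have step: "((\<lambda>p. esum n p / p * (real m / real (m + p))) has_sum hsum (Suc n) m) {0<..}"
    if *: "\<And>m. ((\<lambda>p. esum n p / (real (m + p) * real (Suc m + p))) has_sum hsum n (Suc m) / Suc m) {0<..}"
    for n m
  proof (induction m)
    case 0
    show ?case by (simp add: hsum_Suc_0 has_sum_0)
  next
    case (Suc m)
    have "((\<lambda>p. esum n p / p * (real m / real (m + p)) + esum n p / (real (m + p) * real (Suc m + p)))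
        has_sum hsum (Suc n) (Suc m)) {0<..}"
      unfolding hsum_Suc_Suc by (intro has_sum_add Suc *)
    moreover have "esum n p / p * (real m / real (m + p)) + esum n p / (real (m + p) * real (Suc m + p))
        = esum n p / p * (real (Suc m) / real (Suc m + p))" if "p \<in> {0<..}" for p
      using that by (simp add: divide_simps) (simp add: algebra_simps)
    ultimately show ?case
      by (simp only: cong: has_sum_cong)
  qed
  {
    case 0
    show ?case by (rule step) (use has_sum_shifted_product[of _ 0] in simp)
  next
    case (Suc n)
    show ?case by (rule step) (intro has_sum_esum_shifted_product Suc)
  }
qed

text \<open>The depth-one case of \<open>has_sum_hsum\<close> with the two variables
  exchanged.\<close>

lemma has_sum_inverse_shifted:
  assumes "0 < p"
  shows "((\<lambda>m. 1 / (real m * real (m + p))) has_sum harm p / p) {0<..}"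
proof -
  have "hsum (Suc 0) p = harm p"
    by (induction p) (simp_all add: hsum_Suc_0 hsum_Suc_Suc harm_expand harm_Suc inverse_eq_divide)
  then show ?thesis
    using has_sum_cmult_left[OF has_sum_hsum[of 0 p], of "1 / p"] assms
    by (simp add: add.commute mult_ac)
qed

text \<open>The induction step is the partial fraction
  \<open>1 / (m\<^sup>k (m + p)) = (1 / p) (1 / m\<^sup>k - 1 / (m\<^bsup>k-1\<^esup> (m + p)))\<close>.\<close>

lemma has_sum_partial_fractions:
  "((\<lambda>(m, p). esum n p / (real m ^ Suc k * real p ^ Suc j * real (m + p))) has_sum
     ((\<Sum>i<k. (-1) ^ i * Z (k + 1 - i) 0 * Z (j + i + 2) n) + (-1) ^ k * T (j + k + 2) n))
     ({0<..} \<times> {0<..})"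
proof (induction k arbitrary: j)
  case 0
  \<comment> \<open>Without further powers of \<open>m\<close>, summing over \<open>m\<close> first
    produces the harmonic number in \<open>T\<close>.\<close>
  let ?f = "\<lambda>(p, m). esum n p / real p ^ Suc j * (1 / (real m * real (m + p)))"
  have inner: "((\<lambda>m. ?f (p, m)) has_sum esum n p / real p ^ Suc j * (harm p / p)) {0<..}"
    if "p \<in> {0<..}" for p
    unfolding prod.case using that by (intro has_sum_cmult_right has_sum_inverse_shifted) auto
  have outer: "((\<lambda>p. esum n p / real p ^ Suc j * (harm p / p)) has_sum T (j + 2) n) {0<..}"
    using has_sum_T[of "j + 2" n] by (simp add: mult_ac)
  have "?f summable_on {0<..} \<times> {0<..}"
    by (rule summable_on_SigmaI[OF inner])
      (use outer in \<open>auto simp: summable_on_def nested_sum_nonneg\<close>)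
  then have "(?f has_sum T (j + 2) n) ({0<..} \<times> {0<..})"
    by (intro has_sum_SigmaI[OF _ outer] inner)
  then show ?case
    by (subst has_sum_swap) (simp add: mult_ac case_prod_unfold)
next
  case (Suc k)
  \<comment> \<open>The first partial fraction separates into a product of two zeta values; the
    second is the induction hypothesis with \<open>j\<close> raised by one.\<close>
  let ?f = "\<lambda>(m, p). 1 / real m ^ (k + 2) * (esum n p / real p ^ (j + 2))"
  have inner: "((\<lambda>p. ?f (m, p)) has_sum 1 / real m ^ (k + 2) * Z (j + 2) n) {0<..}" for m
    unfolding prod.case by (intro has_sum_cmult_right has_sum_Z) auto
  have outer: "((\<lambda>m. 1 / real m ^ (k + 2) * Z (j + 2) n) has_sum Z (k + 2) 0 * Z (j + 2) n) {0<..}"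
    using has_sum_Z[of "k + 2" 0] by (intro has_sum_cmult_left) simp
  have "?f summable_on {0<..} \<times> {0<..}"
    by (rule summable_on_SigmaI[OF inner])
      (use outer in \<open>auto simp: summable_on_def nested_sum_nonneg\<close>)
  then have "(?f has_sum Z (k + 2) 0 * Z (j + 2) n) ({0<..} \<times> {0<..})"
    by (rule has_sum_SigmaI[OF inner outer])
  from has_sum_diff_real[OF this Suc[of "Suc j"]]
  have "((\<lambda>x. ?f x - (case x of (m, p) \<Rightarrow> esum n p / (real m ^ Suc k * real p ^ Suc (Suc j) * real (m + p))))
    has_sum Z (k + 2) 0 * Z (j + 2) n -
      ((\<Sum>i<k. (-1) ^ i * Z (k + 1 - i) 0 * Z (Suc j + i + 2) n) + (-1) ^ k * T (Suc j + k + 2) n))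
    ({0<..} \<times> {0<..})" .
  also have "?this \<longleftrightarrow> ((\<lambda>(m, p). esum n p / (real m ^ Suc (Suc k) * real p ^ Suc j * real (m + p)))
    has_sum Z (k + 2) 0 * Z (j + 2) n -
      ((\<Sum>i<k. (-1) ^ i * Z (k + 1 - i) 0 * Z (Suc j + i + 2) n) + (-1) ^ k * T (Suc j + k + 2) n))
    ({0<..} \<times> {0<..})"
  proof (rule has_sum_cong, safe)
    fix m p :: nat assume "0 < m" "0 < p"
    then have "1 / real m ^ 2 * (1 / real p ^ 2) - 1 / (real m * real p ^ 2 * real (m + p))
        = 1 / (real m ^ 2 * real p * real (m + p))"
      by (simp add: divide_simps power2_eq_square)
    then have "esum n p / (real m ^ k * real p ^ j) *
          (1 / real m ^ 2 * (1 / real p ^ 2) - 1 / (real m * real p ^ 2 * real (m + p)))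
        = esum n p / (real m ^ k * real p ^ j) * (1 / (real m ^ 2 * real p * real (m + p)))"
      by (rule arg_cong)
    then show "1 / real m ^ (k + 2) * (esum n p / real p ^ (j + 2))
          - esum n p / (real m ^ Suc k * real p ^ Suc (Suc j) * real (m + p))
        = esum n p / (real m ^ Suc (Suc k) * real p ^ Suc j * real (m + p))"
      by (simp add: right_diff_distrib power_add power2_eq_square mult_ac)
  qed
  also have "Z (k + 2) 0 * Z (j + 2) n -
      ((\<Sum>i<k. (-1) ^ i * Z (k + 1 - i) 0 * Z (Suc j + i + 2) n) + (-1) ^ k * T (Suc j + k + 2) n)
    = (\<Sum>i<Suc k. (-1) ^ i * Z (Suc k + 1 - i) 0 * Z (j + i + 2) n) + (-1) ^ Suc k * T (j + Suc k + 2) n"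
    by (simp add: sum.lessThan_Suc_shift sum_negf del: sum.lessThan_Suc)
  finally show ?case .
qed

text \<open>Take \<open>j = 0\<close> in the double sum; summing over \<open>p\<close> first yields
  \<open>hsum (Suc n) m\<close> by \<open>has_sum_hsum\<close>.\<close>

lemma mzsv_eq:
  "mzsv ((k + 2) # replicate (Suc n) 1) =
    (\<Sum>i<k. (-1) ^ i * Z (k + 1 - i) 0 * Z (i + 2) n) + (-1) ^ k * T (k + 2) n"
proof (rule mzsv_eqI)
  have "((\<lambda>m. 1 / real m ^ (k + 2) * hsum (Suc n) m) has_sum
     ((\<Sum>i<k. (-1) ^ i * Z (k + 1 - i) 0 * Z (0 + i + 2) n) + (-1) ^ k * T (0 + k + 2) n)) {0<..}"
  proof (rule has_sum_Sigma'[OF has_sum_partial_fractions])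
    fix m :: nat assume "m \<in> {0<..}"
    then have "esum n p / (real m ^ Suc k * real p ^ Suc 0 * real (m + p))
      = 1 / real m ^ (k + 2) * (esum n p / p * (real m / real (m + p)))" for p
      by (simp add: divide_simps)
    then show "((\<lambda>p. case (m, p) of (m, p) \<Rightarrow> esum n p / (real m ^ Suc k * real p ^ Suc 0 * real (m + p)))
        has_sum 1 / real m ^ (k + 2) * hsum (Suc n) m) {0<..}"
      unfolding prod.case by (simp only:) (intro has_sum_cmult_right has_sum_hsum)
  qed
  then show "((\<lambda>m. hsum (Suc n) m / real m ^ (k + 2)) has_sum
     ((\<Sum>i<k. (-1) ^ i * Z (k + 1 - i) 0 * Z (i + 2) n) + (-1) ^ k * T (k + 2) n)) {0<..}"
    by simp
qed

section \<open>Combining the star expansion, duality and the exchange formula for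
  \<open>T\<close>\<close>

theorem theorem2p1:
  fixes k n :: nat
  assumes "k \<ge> 1" and "n \<ge> 1"
  shows "(-1) ^ k * mzsv ((k + 1) # replicate n 1) - (-1) ^ n * mzsv ((n + 1) # replicate k 1)
       = real k * mzv ((k + 2) # replicate (n - 1) 1) - real n * mzv ((n + 2) # replicate (k - 1) 1)
         + (-1) ^ k * (\<Sum>r<k - 1. (-1) ^ r * mzv [k - r] * mzv ((n + 1) # replicate r 1))
         - (-1) ^ n * (\<Sum>r<n - 1. (-1) ^ r * mzv [n - r] * mzv ((k + 1) # replicate r 1))"
proof -
  obtain K N where k: "k = Suc K" and n: "n = Suc N"
    using assms by (metis Suc_le_D One_nat_def)
  \<comment> \<open>The sign has one more factor -1 than the one in front of \<open>T\<close> in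
    \<open>mzsv_eq\<close>, so \<open>T\<close> enters with coefficient -1 whatever the
    parity.\<close>
  have star: "(-1) ^ Suc a * mzsv ((Suc a + 1) # replicate (Suc b) 1)
      = (-1) ^ Suc a * (\<Sum>r<a. (-1) ^ r * mzv [Suc a - r] * mzv ((Suc b + 1) # replicate r 1)) - T (a + 2) b"
    for a b
  proof -
    have "(\<Sum>r<a. (-1) ^ r * mzv [Suc a - r] * mzv ((Suc b + 1) # replicate r 1))
        = (\<Sum>r<a. (-1) ^ r * Z (a + 1 - r) 0 * Z (r + 2) b)"
    proof (rule sum.cong[OF refl])
      fix r assume "r \<in> {..<a}"
      then have "mzv [Suc a - r] = Z (a + 1 - r) 0"
        using mzv_eq_Z[of "a + 1 - r" 0] by simp
      moreover have "mzv ((Suc b + 1) # replicate r 1) = Z (r + 2) b"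
        using mzv_eq_Z[of "b + 2" r] Z_duality[of r b] by simp
      ultimately show "(-1) ^ r * mzv [Suc a - r] * mzv ((Suc b + 1) # replicate r 1)
          = (-1) ^ r * Z (a + 1 - r) 0 * Z (r + 2) b"
        by (simp only:)
    qed
    moreover have "(-1) ^ Suc a * ((-1) ^ a * x) = - x" for x :: real
      by (simp flip: mult.assoc power_mult_distrib)
    ultimately show ?thesis
      using mzsv_eq[of a b] by (simp add: ring_distribs del: power_Suc)
  qed
  \<comment> \<open>Duality turns \<open>Z (N + 2) (Suc K)\<close> into \<open>Z (K + 3) N\<close>,
    the form in which zeta(k+2,1,...,1) occurs in the claim.\<close>
  have "T (N + 2) K - T (K + 2) N = Suc K * Z (K + 3) N - Suc N * Z (N + 3) K"
    using T_swap[of N K] Z_duality[of "Suc K" N] by (simp add: numeral_3_eq_3)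
  moreover have "mzv ((Suc a + 2) # replicate (Suc b - 1) 1) = Z (a + 3) b" for a b
    using mzv_eq_Z[of "a + 3" b] by (simp add: numeral_3_eq_3)
  ultimately show ?thesis
    unfolding k n star by simp
qed

end
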